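(* For every integer $k \geq 1$, \[ \left| \frac{\pi}{4} - GLS_k \right| < \frac{1}{8} \left( \frac{1}{2k+6} - \frac{6}{2k+5} + \frac{14}{2k+4} - \frac{14}{2k+3} + \frac{1}{2k+2} + \frac{8}{2k+1} \right) \] \[ = \frac{16k^5+168k^4+696k^3+1428k^2+1454k+567}{64k^6+672k^5+2800k^4+5880k^3+6496k^2+3528k+720} \] and \[ \left| \frac{\pi}{4} - GLS_k \right| > \frac{1}{8} \left( - \frac{1}{2k+4} + \frac{6}{2k+3} - \frac{14}{2k+2} + \frac{14}{2k+1} - \frac{1}{2k} \right) \] \[ = \frac{8k^4+40k^3+68k^2+40k-3}{32k^5+160k^4+280k^3+200k^2+48k}. \]
   Context: For an integer $k \geq 1$, $GLS_k$ denotes the $k$th partial sum of the Gregory-Leibniz series, $GLS_k := \sum_{i=1}^{k} (-1)^{i+1} \frac{1}{2i-1}$. *)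

theory Defs
  imports Complex_Main
begin

definition GLS :: "nat \<Rightarrow> real" where
  "GLS k = (\<Sum>i=1..k. (-1) ^ (i + 1) * (1 / (2 * real i - 1)))"

end

theory Submission
  imports Defs
begin

text \<open>
  The signed remainder \<open>R k = (- 1) ^ k * (pi / 4 - GLS k)\<close> tends to \<open>0\<close> and satisfies
  \<open>R k + R (k + 1) = 1 / (2 * k + 1)\<close>. If \<open>L\<close> denotes the lower bound, then \<open>L k - L (k + 2)\<close> falls
  short of \<open>R k - R (k + 2)\<close> by a positive amount (a constant over a product of linear factors), so
  \<open>R - L\<close> decreases strictly to \<open>0\<close> along steps of length 2 and is therefore positive. The upper
  bound is \<open>1 / (2 * k + 1) - L (k + 1)\<close>, so it follows from the lower bound for \<open>R (k + 1)\<close>.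
\<close>

definition GLS_rem :: "nat \<Rightarrow> real" where
  "GLS_rem k = (-1) ^ k * (pi / 4 - GLS k)"

definition GLS_lower :: "nat \<Rightarrow> real" where
  "GLS_lower k = 1 / 8 * (- (1 / (2 * real k + 4)) + 6 / (2 * real k + 3) - 14 / (2 * real k + 2)
                 + 14 / (2 * real k + 1) - 1 / (2 * real k))"

lemma abs_GLS_rem: "\<bar>GLS_rem k\<bar> = \<bar>pi / 4 - GLS k\<bar>"
  by (simp add: GLS_rem_def abs_mult power_abs)

text \<open>Shifting the index to start at 0 matches the form of \<open>pi_series\<close> and
  \<open>sums_def\<close>, and lets \<open>Suc k\<close> split off the last term.\<close>

lemma GLS_conv_lessThan: "GLS k = (\<Sum>i<k. (-1) ^ i * (1 / real (i * 2 + 1)))"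
  by (induction k) (simp_all add: GLS_def algebra_simps)

lemma GLS_tendsto: "GLS \<longlonglongrightarrow> pi / 4"
proof -
  \<comment> \<open>This is the arctangent series at the boundary point 1 of its interval of
    convergence.\<close>
  have "summable (\<lambda>k. (-1) ^ k * (1 / real (k * 2 + 1) * (1::real) ^ (k * 2 + 1)))"
    by (rule summable_arctan_series) simp
  then have "(\<lambda>k. (-1) ^ k * (1 / real (k * 2 + 1))) sums (\<Sum>k. (-1) ^ k * (1 / real (k * 2 + 1)))"
    by (simp add: summable_sums)
  then show ?thesis
    by (simp add: sums_def pi_series GLS_conv_lessThan[abs_def])
qed

lemma GLS_rem_tendsto: "GLS_rem \<longlonglongrightarrow> 0"
proof -
  have "(\<lambda>k. \<bar>pi / 4 - GLS k\<bar>) \<longlonglongrightarrow> \<bar>pi / 4 - pi / 4\<bar>"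
    by (intro tendsto_intros GLS_tendsto)
  then have "(\<lambda>k. \<bar>GLS_rem k\<bar>) \<longlonglongrightarrow> 0"
    by (simp add: abs_GLS_rem)
  then show ?thesis
    by (rule tendsto_rabs_zero_cancel)
qed

text \<open>The alternating sign cancels \<open>pi / 4\<close>, leaving \<open>(-1) ^ k\<close>
  times the newly added term, whose own sign is also \<open>(-1) ^ k\<close>.\<close>

lemma GLS_rem_Suc: "GLS_rem k + GLS_rem (Suc k) = 1 / (2 * real k + 1)"
proof -
  have "(-1) ^ k * (-1) ^ k = (1::real)"
    by (simp flip: power_mult_distrib)
  then show ?thesis
    by (simp add: GLS_rem_def GLS_conv_lessThan algebra_simps)
qed

lemma GLS_lower_tendsto: "GLS_lower \<longlonglongrightarrow> 0"
proof -
  have *: "(\<lambda>k. c / (2 * real k + d)) \<longlonglongrightarrow> 0" for c d :: real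
  proof -
    have "filterlim (\<lambda>k. d + 2 * real k) at_top sequentially"
      by (intro filterlim_tendsto_add_at_top[OF tendsto_const]
          filterlim_tendsto_pos_mult_at_top[OF tendsto_const] filterlim_real_sequentially) simp
    then have "filterlim (\<lambda>k. 2 * real k + d) at_infinity sequentially"
      by (simp add: add.commute filterlim_at_top_imp_at_infinity)
    then show ?thesis
      by (rule tendsto_divide_0[OF tendsto_const])
  qed
  have "GLS_lower \<longlonglongrightarrow> 1 / 8 * (- 0 + 0 - 0 + 0 - 0)"
    unfolding GLS_lower_def
    \<comment> \<open>The instance \<open>d = 0\<close> covers the summand
      \<open>1 / (2 * real k)\<close>, which has no visible offset.\<close>
    using *[of _ 0] by (intro tendsto_intros *) simp
  then show ?thesis
    by simp
qed

lemma diff_inverse_symmetric: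
  fixes c d y :: real
  assumes "y \<noteq> d" "y \<noteq> - d"
  shows "c / (y - d) - c / (y + d) = 2 * c * d / (y ^ 2 - d ^ 2)"
proof -
  have "y - d \<noteq> 0" "y + d \<noteq> 0"
    using assms by auto
  moreover have "y ^ 2 - d ^ 2 = (y - d) * (y + d)"
    by algebra
  ultimately show ?thesis
    by (simp add: diff_frac_eq) (simp add: algebra_simps)
qed

text \<open>
  In the centred variable \<open>y\<close> the poles of the difference are \<open>\<plusminus>1\<close>, \<open>\<plusminus>2\<close>, \<open>\<plusminus>3\<close> and \<open>\<plusminus>4\<close>, with opposite
  residues at \<open>d\<close> and \<open>-d\<close>; combining them in pairs leaves a rational function of \<open>y ^ 2\<close>.
\<close>

lemma GLS_lower_step:
  assumes "k \<ge> 1"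
  defines "y \<equiv> 2 * real k + 4"
  shows "1 / (2 * real k + 1) - 1 / (2 * real k + 3) - (GLS_lower k - GLS_lower (k + 2)) =
    1260 / ((y ^ 2 - 1) * (y ^ 2 - 4) * (y ^ 2 - 9) * (y ^ 2 - 16))"
proof -
  have "y \<ge> 6"
    using assms by simp
  have "y ^ 2 > 16"
    using power_strict_mono[of 4 y 2] \<open>y \<ge> 6\<close> by simp
  have x: "2 * real k = y - 4" "2 * real (k + 2) = y"
      "y - 4 + 1 = y - 3" "y - 4 + 2 = y - 2" "y - 4 + 3 = y - 1" "y - 4 + 4 = y"
    by (simp_all add: y_def)
  \<comment> \<open>The two \<open>1 / y\<close> terms cancel. Adding 8 at \<open>y - 3\<close> and
    -8 at \<open>y - 1\<close> turns the coefficients -14 and -6 of \<open>- GLS_lower k\<close>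
    into -6 and -14, opposite to those at \<open>y + 3\<close> and \<open>y + 1\<close>.\<close>
  have "1 / (2 * real k + 1) - 1 / (2 * real k + 3) - (GLS_lower k - GLS_lower (k + 2)) =
      1 / 8 * ((1 / (y - 4) - 1 / (y + 4)) - (6 / (y - 3) - 6 / (y + 3))
        + (14 / (y - 2) - 14 / (y + 2)) - (14 / (y - 1) - 14 / (y + 1)))"
    unfolding GLS_lower_def x
    by (simp only: divide_inverse[of _ "y + _"] divide_inverse[of _ "y - _"] divide_inverse[of _ y]
        ring_distribs)
  also have "\<dots> = 1 / 8 * (8 / (y ^ 2 - 16) - 36 / (y ^ 2 - 9) + 56 / (y ^ 2 - 4) - 28 / (y ^ 2 - 1))"
    using diff_inverse_symmetric[of y 4 1] diff_inverse_symmetric[of y 3 6]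
      diff_inverse_symmetric[of y 2 14] diff_inverse_symmetric[of y 1 14] \<open>y \<ge> 6\<close>
    by simp
  also have "\<dots> = 1260 / ((y ^ 2 - 1) * (y ^ 2 - 4) * (y ^ 2 - 9) * (y ^ 2 - 16))"
  proof -
    \<comment> \<open>A partial fraction identity in \<open>s = y ^ 2\<close>; all powers of
      \<open>s\<close> cancel from the numerator, so its sign is evident.\<close>
    have "1 / 8 * (8 / (s - 16) - 36 / (s - 9) + 56 / (s - 4) - 28 / (s - 1)) =
        1260 / ((s - 1) * (s - 4) * (s - 9) * (s - 16))" if "s > 16" for s :: real
      using that by (simp add: divide_simps) algebra
    from this[OF \<open>y ^ 2 > 16\<close>] show ?thesis .
  qed
  finally show ?thesis .
qed

lemma GLS_lower_less_rem:
  assumes "k \<ge> 1"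
  shows "GLS_lower k < GLS_rem k"
proof -
  define h where "h n = GLS_rem n - GLS_lower n" for n
  have step: "h (n + 2) < h n" if "n \<ge> 1" for n
  proof -
    have "(2 * real n + 4) ^ 2 > 16"
      using power_strict_mono[of 4 "2 * real n + 4" 2] that by simp
    then have "1 / (2 * real n + 1) - 1 / (2 * real n + 3) - (GLS_lower n - GLS_lower (n + 2)) > 0"
      unfolding GLS_lower_step[OF that] by (intro divide_pos_pos mult_pos_pos) simp_all
    moreover have "GLS_rem n - GLS_rem (n + 2) = 1 / (2 * real n + 1) - 1 / (2 * real n + 3)"
      using GLS_rem_Suc[of n] GLS_rem_Suc[of "Suc n"] by (simp add: algebra_simps)
    ultimately show ?thesis
      by (simp add: h_def)
  qed
  \<comment> \<open>Starting at \<open>k + 2\<close> keeps one step in reserve: the limit only gives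
    \<open>h (k + 2) \<ge> 0\<close>, and the strict step from \<open>k\<close> then gives
    \<open>h k > 0\<close>.\<close>
  have "decseq (\<lambda>n. h (k + 2 + 2 * n))"
    using step[of "k + 2 + 2 * n" for n] by (intro decseq_SucI) (simp add: less_imp_le)
  moreover have "(\<lambda>n. h (k + 2 + 2 * n)) \<longlonglongrightarrow> 0"
  proof -
    have "h \<longlonglongrightarrow> 0 - 0"
      unfolding h_def by (intro tendsto_diff GLS_rem_tendsto GLS_lower_tendsto)
    moreover have "strict_mono (\<lambda>n. k + 2 + 2 * n)"
      by (auto simp: strict_mono_def)
    ultimately show ?thesis
      using LIMSEQ_subseq_LIMSEQ by (fastforce simp: o_def)
  qed
  ultimately have "h (k + 2) \<ge> 0"
    using decseq_ge[of _ 0 0] by fastforce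
  then show ?thesis
    using step[OF assms] by (simp add: h_def)
qed

lemma GLS_lower_eq:
  assumes "k \<ge> 1"
  shows "GLS_lower k = (8 * real k ^ 4 + 40 * real k ^ 3 + 68 * real k ^ 2 + 40 * real k - 3) /
    (32 * real k ^ 5 + 160 * real k ^ 4 + 280 * real k ^ 3 + 200 * real k ^ 2 + 48 * real k)"
proof -
  define x u where "x = real k" and "u = 2 * x"
  have "u > 0"
    using assms by (simp add: x_def u_def)
  let ?D = "u * (u + 1) * (u + 2) * (u + 3) * (u + 4)"
  have "1 / 8 * (- (1 / (u + 4)) + 6 / (u + 3) - 14 / (u + 2) + 14 / (u + 1) - 1 / u) * ?D =
      1 / 8 * (- (u * (u + 1) * (u + 2) * (u + 3)) + 6 * (u * (u + 1) * (u + 2) * (u + 4))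
        - 14 * (u * (u + 1) * (u + 3) * (u + 4)) + 14 * (u * (u + 2) * (u + 3) * (u + 4))
        - (u + 1) * (u + 2) * (u + 3) * (u + 4))"
    using \<open>u > 0\<close> by (simp add: distrib_right[of _ _ ?D] left_diff_distrib[of _ _ ?D])
  also have "\<dots> = 8 * x ^ 4 + 40 * x ^ 3 + 68 * x ^ 2 + 40 * x - 3"
    unfolding u_def by algebra
  finally have "1 / 8 * (- (1 / (u + 4)) + 6 / (u + 3) - 14 / (u + 2) + 14 / (u + 1) - 1 / u) =
      (8 * x ^ 4 + 40 * x ^ 3 + 68 * x ^ 2 + 40 * x - 3) / ?D"
    using \<open>u > 0\<close> by (subst nonzero_eq_divide_eq) simp_all
  also have "?D = 32 * x ^ 5 + 160 * x ^ 4 + 280 * x ^ 3 + 200 * x ^ 2 + 48 * x"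
    unfolding u_def by algebra
  finally show ?thesis
    unfolding GLS_lower_def u_def x_def .
qed

text \<open>In the closed form, \<open>40 * real k\<close> outweighs the only negative term, -3.
  Positivity of the bound passes to \<open>GLS_rem k\<close>, which removes the absolute
  value.\<close>

lemma GLS_lower_pos:
  assumes "k \<ge> 1"
  shows "GLS_lower k > 0"
proof -
  have "real k \<ge> 1" "real k ^ 2 > 0" "real k ^ 3 > 0" "real k ^ 4 > 0" "real k ^ 5 > 0"
    using assms by simp_all
  then show ?thesis
    unfolding GLS_lower_eq[OF assms] by (intro divide_pos_pos) linarith+
qed

lemma GLS_upper_eq:
  "1 / 8 * (1 / (2 * real k + 6) - 6 / (2 * real k + 5) + 14 / (2 * real k + 4)
      - 14 / (2 * real k + 3) + 1 / (2 * real k + 2) + 8 / (2 * real k + 1)) =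
    (16 * real k ^ 5 + 168 * real k ^ 4 + 696 * real k ^ 3 + 1428 * real k ^ 2
      + 1454 * real k + 567) /
    (64 * real k ^ 6 + 672 * real k ^ 5 + 2800 * real k ^ 4 + 5880 * real k ^ 3
      + 6496 * real k ^ 2 + 3528 * real k + 720)"
proof -
  define x u where "x = real k" and "u = 2 * x"
  have "u \<ge> 0"
    by (simp add: x_def u_def)
  let ?D = "(u + 1) * (u + 2) * (u + 3) * (u + 4) * (u + 5) * (u + 6)"
  have "1 / 8 * (1 / (u + 6) - 6 / (u + 5) + 14 / (u + 4) - 14 / (u + 3) + 1 / (u + 2)
        + 8 / (u + 1)) * ?D =
      1 / 8 * ((u + 1) * (u + 2) * (u + 3) * (u + 4) * (u + 5)
        - 6 * ((u + 1) * (u + 2) * (u + 3) * (u + 4) * (u + 6))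
        + 14 * ((u + 1) * (u + 2) * (u + 3) * (u + 5) * (u + 6))
        - 14 * ((u + 1) * (u + 2) * (u + 4) * (u + 5) * (u + 6))
        + (u + 1) * (u + 3) * (u + 4) * (u + 5) * (u + 6)
        + 8 * ((u + 2) * (u + 3) * (u + 4) * (u + 5) * (u + 6)))"
    using \<open>u \<ge> 0\<close> by (simp add: distrib_right[of _ _ ?D] left_diff_distrib[of _ _ ?D])
  also have "\<dots> = 16 * x ^ 5 + 168 * x ^ 4 + 696 * x ^ 3 + 1428 * x ^ 2 + 1454 * x + 567"
    unfolding u_def by algebra
  finally have "1 / 8 * (1 / (u + 6) - 6 / (u + 5) + 14 / (u + 4) - 14 / (u + 3) + 1 / (u + 2)
        + 8 / (u + 1)) =
      (16 * x ^ 5 + 168 * x ^ 4 + 696 * x ^ 3 + 1428 * x ^ 2 + 1454 * x + 567) / ?D"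
    using \<open>u \<ge> 0\<close> by (subst nonzero_eq_divide_eq) simp_all
  also have "?D = 64 * x ^ 6 + 672 * x ^ 5 + 2800 * x ^ 4 + 5880 * x ^ 3 + 6496 * x ^ 2
      + 3528 * x + 720"
    unfolding u_def by algebra
  finally show ?thesis
    unfolding u_def x_def .
qed

theorem proposition3:
  fixes k :: nat
  assumes "k \<ge> 1"
  shows "
    \<bar>pi / 4 - GLS k\<bar> <
       1 / 8 * (1 / (2 * real k + 6) - 6 / (2 * real k + 5) + 14 / (2 * real k + 4)
                - 14 / (2 * real k + 3) + 1 / (2 * real k + 2) + 8 / (2 * real k + 1)) \<and>
    1 / 8 * (1 / (2 * real k + 6) - 6 / (2 * real k + 5) + 14 / (2 * real k + 4)
              - 14 / (2 * real k + 3) + 1 / (2 * real k + 2) + 8 / (2 * real k + 1)) =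
       (16 * real k ^ 5 + 168 * real k ^ 4 + 696 * real k ^ 3 + 1428 * real k ^ 2
         + 1454 * real k + 567) /
       (64 * real k ^ 6 + 672 * real k ^ 5 + 2800 * real k ^ 4 + 5880 * real k ^ 3
         + 6496 * real k ^ 2 + 3528 * real k + 720) \<and>
    \<bar>pi / 4 - GLS k\<bar> >
       1 / 8 * (- (1 / (2 * real k + 4)) + 6 / (2 * real k + 3) - 14 / (2 * real k + 2)
                + 14 / (2 * real k + 1) - 1 / (2 * real k)) \<and>
    1 / 8 * (- (1 / (2 * real k + 4)) + 6 / (2 * real k + 3) - 14 / (2 * real k + 2)
              + 14 / (2 * real k + 1) - 1 / (2 * real k)) =
       (8 * real k ^ 4 + 40 * real k ^ 3 + 68 * real k ^ 2 + 40 * real k - 3) /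
       (32 * real k ^ 5 + 160 * real k ^ 4 + 280 * real k ^ 3 + 200 * real k ^ 2 + 48 * real k)"
proof -
  have pos: "\<bar>pi / 4 - GLS k\<bar> = GLS_rem k"
    using GLS_lower_less_rem[OF assms] GLS_lower_pos[OF assms] by (simp flip: abs_GLS_rem)
  have "GLS_rem k < 1 / (2 * real k + 1) - GLS_lower (k + 1)"
    using GLS_rem_Suc[of k] GLS_lower_less_rem[of "k + 1"] by simp
  \<comment> \<open>Replacing \<open>k\<close> by \<open>k + 1\<close> moves every denominator up by
    2; the coefficient 8 comes from pulling \<open>1 / 8\<close> out of
    \<open>1 / (2 * real k + 1)\<close>.\<close>
  also have "\<dots> = 1 / 8 * (1 / (2 * real k + 6) - 6 / (2 * real k + 5) + 14 / (2 * real k + 4)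
                - 14 / (2 * real k + 3) + 1 / (2 * real k + 2) + 8 / (2 * real k + 1))"
    by (simp add: GLS_lower_def algebra_simps)
  finally show ?thesis
    using GLS_lower_less_rem[OF assms] GLS_lower_eq[OF assms] GLS_upper_eq[of k]
    unfolding pos GLS_lower_def by blast
qed

end
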